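(* Let $\omega:[0,1]\to\mathbb{R}_{+}$ be a modulus of continuity such that for some $0<\alpha<1$ the function $\frac{\omega(x)}{x^{\alpha}}$ is decreasing on $(0,a(\alpha))$, where $0<a(\alpha)<1$. Then there exists a diffeomorphism $f\in\mathrm{Diff}^{\omega}_0[0,1]$ with $\gamma(f)=1$ such that for each $\varepsilon>0$ there is a constant $c(\varepsilon)>0$ with $$\log\Gamma_n(f)\ge c(\varepsilon)\,n^{1-\varepsilon}\,\omega\left(\frac1n\right)$$ for all sufficiently large $n$ (how large may depend on $\varepsilon$).
   Context: $\mathrm{Diff}_0[0,1]$ is the group of all $C^1$-smooth diffeomorphisms of $[0,1]$ fixing the end points $0$ and $1$. For $f\in\mathrm{Diff}_0[0,1]$ and $n\in\mathbb{N}$, the growth sequence is $\Gamma_n(f)=\max\{\|(f^n)'\|_\infty,\|(f^{-n})'\|_\infty\}$, where $f^n$ is the $n$-th iterate and $\|\cdot\|_\infty$ is the uniform norm on $[0,1]$; and $\gamma(f)=\lim_{n\to\infty}\sqrt[n]{\Gamma_n(f)}$ (the limit exists by submultiplicativity). A modulus of continuity is a non-decreasing continuous function $\omega:[0,1]\to\mathbb{R}_+=[0,\infty)$ with $\omega(0)=0$ and $\omega(\delta_1+\delta_2)\le\omega(\delta_1)+\omega(\delta_2)$ whenever $\delta_1,\delta_2,\delta_1+\delta_2\in[0,1]$. For a modulus of continuity $\omega$, $\mathrm{Diff}^{\omega}_0[0,1]$ is the set of $f\in\mathrm{Diff}_0[0,1]$ for which there is a constant $K(f)$ with $\omega_{f'}(\delta)\le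 K(f)\,\omega(\delta)$ for all $\delta\in[0,1]$, where $\omega_{f'}(\delta)=\max_{|x-y|\le\delta}|f'(x)-f'(y)|$. *)

theory Defs
  imports "HOL-Analysis.Analysis"
begin

text \<open>
  Maps of \<open>[0,1]\<close> are represented by functions on the reals. Only their values on \<open>[0,1]\<close> matter:
  derivatives are taken within \<open>[0,1]\<close>, so they are one-sided at \<open>0\<close> and \<open>1\<close>, and inverses are
  taken with respect to \<open>[0,1]\<close>.
\<close>

definition deriv01 :: "(real \<Rightarrow> real) \<Rightarrow> real \<Rightarrow> real" where
  "deriv01 f x = vector_derivative f (at x within {0..1})"

definition inv01 :: "(real \<Rightarrow> real) \<Rightarrow> real \<Rightarrow> real" where
  "inv01 f = inv_into {0..1} f"

definition C1_on01 :: "(real \<Rightarrow> real) \<Rightarrow> bool" where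
  "C1_on01 f \<longleftrightarrow> f differentiable_on {0..1} \<and> continuous_on {0..1} (deriv01 f)"

definition Diff0 :: "(real \<Rightarrow> real) set" where
  "Diff0 = {f. bij_betw f {0..1} {0..1} \<and> f 0 = 0 \<and> f 1 = 1 \<and> C1_on01 f \<and> C1_on01 (inv01 f)}"

definition supnorm01 :: "(real \<Rightarrow> real) \<Rightarrow> real" where
  "supnorm01 g = (SUP x\<in>{0..1}. \<bar>g x\<bar>)"

definition growth_seq :: "(real \<Rightarrow> real) \<Rightarrow> nat \<Rightarrow> real" where
  "growth_seq f n = max (supnorm01 (deriv01 (f ^^ n))) (supnorm01 (deriv01 (inv01 f ^^ n)))"

text \<open>For \<open>f\<close> in \<^const>\<open>Diff0\<close> the limit exists, because \<^term>\<open>growth_seq f\<close> is submultiplicative.\<close>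

definition growth_rate :: "(real \<Rightarrow> real) \<Rightarrow> real" where
  "growth_rate f = lim (\<lambda>n. root n (growth_seq f n))"

definition modulus_of_continuity :: "(real \<Rightarrow> real) \<Rightarrow> bool" where
  "modulus_of_continuity \<omega> \<longleftrightarrow>
     (\<forall>x\<in>{0..1}. 0 \<le> \<omega> x) \<and> mono_on {0..1} \<omega> \<and> continuous_on {0..1} \<omega> \<and> \<omega> 0 = 0 \<and>
     (\<forall>s t. s \<in> {0..1} \<and> t \<in> {0..1} \<and> s + t \<in> {0..1} \<longrightarrow> \<omega> (s + t) \<le> \<omega> s + \<omega> t)"

definition oscillation01 :: "(real \<Rightarrow> real) \<Rightarrow> real \<Rightarrow> real" where
  "oscillation01 g \<delta> = Sup {\<bar>g x - g y\<bar> |x y. x \<in> {0..1} \<and> y \<in> {0..1} \<and> \<bar>x - y\<bar> \<le> \<delta>}"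

definition Diff0_mod :: "(real \<Rightarrow> real) \<Rightarrow> (real \<Rightarrow> real) set" where
  "Diff0_mod \<omega> =
     {f \<in> Diff0. \<exists>K. \<forall>\<delta>\<in>{0..1}. oscillation01 (deriv01 f) \<delta> \<le> K * \<omega> \<delta>}"

end

theory Submission
  imports Defs "HOL-Real_Asymp.Real_Asymp"
begin

text \<open>
  If \<open>\<omega> 1 = 0\<close> then \<open>\<omega>\<close> vanishes and the identity is a witness. Otherwise the diffeomorphism \<open>f\<close> is
  built from a decreasing sequence of nodes \<open>1 = z\<^sub>0 > z\<^sub>1 > z\<^sub>2 > \<dots>\<close> with limit \<open>0\<close>, and it acts
  on them by \<open>z\<^sub>k \<mapsto> z\<^sub>k\<^sub>+\<^sub>2\<close> for \<open>k \<ge> 1\<close>. So the even and the odd nodes form two interlaced orbits.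
  Along the even orbit the derivative is \<open>1 + \<omega> (l\<^sub>k)\<close> and along the odd orbit \<open>1 - \<omega> (l\<^sub>k)\<close>, where
  \<open>l\<^sub>k = z\<^sub>k - z\<^sub>k\<^sub>+\<^sub>1\<close>. Up to a constant factor, this is the largest oscillation that the modulus \<open>\<omega>\<close>
  allows over the distance \<open>l\<^sub>k\<close> between neighbours of different parity. Moreover the two signs
  balance, so that the lengths of the intervals between nodes need not change much under \<open>f\<close>.
  The chain rule gives
  \<open>(f\<^sup>n)' (z\<^sub>2) = \<Prod>\<^sub>j\<^sub><\<^sub>n (1 + \<omega> (l\<^sub>2\<^sub>j\<^sub>+\<^sub>2)) \<ge> exp (n \<omega> (l\<^sub>2\<^sub>n) / 2)\<close>.

  The lengths \<open>l\<^sub>k\<close> have a finite sum, so \<open>l\<^sub>k\<close> cannot be of order \<open>1 / k\<close>. With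
  \<open>z\<^sub>k = 1 / ln (k + M)\<close> one has \<open>l\<^sub>k \<approx> 1 / (k ln\<^sup>2 k)\<close>, which exceeds \<open>k\<^sup>-\<^sup>1\<^sup>-\<^sup>\<epsilon>\<close> eventually for every
  \<open>\<epsilon> > 0\<close> at once. Because \<open>\<omega> t / t\<close> is decreasing up to a factor \<open>2\<close>, this costs only the factor
  \<open>n\<^sup>-\<^sup>\<epsilon>\<close> and \<open>n \<omega> (l\<^sub>2\<^sub>n)\<close> is at least a constant times \<open>n\<^sup>1\<^sup>-\<^sup>\<epsilon> \<omega> (1 / n)\<close>.

  Between neighbouring nodes the derivative of \<open>f\<close> is a quadratic polynomial. It is determined by
  its values at the two nodes and by its mean, which for \<open>k \<ge> 1\<close> has to be the ratio
  \<open>l\<^sub>k\<^sub>+\<^sub>2 / l\<^sub>k\<close>. This ratio differs from \<open>1\<close> by \<open>O(1 / k)\<close>. The hypothesis on \<open>\<omega> x / x\<^sup>\<alpha>\<close> enters here: it yields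
  \<open>\<omega> (l\<^sub>k) \<ge> b l\<^sub>k\<^sup>\<alpha> \<ge> b / k\<close> for large \<open>k\<close>, with a constant \<open>b > 0\<close>, so the quadratic correction is
  \<open>O(\<omega> (l\<^sub>k))\<close>, too. Hence the derivative stays within \<open>O(\<omega> (l\<^sub>k))\<close> of \<open>1\<close> and has Lipschitz constant
  \<open>O(\<omega> (l\<^sub>k) / l\<^sub>k)\<close> on the \<open>k\<close>-th interval, and these two facts give the modulus of continuity
  (\<open>slope_modulus\<close>).

  Finally \<open>f x < x\<close> on \<open>(0,1)\<close> and the derivative is \<open>1\<close> at both end points. Then an orbit spends a
  bounded time where \<open>\<bar>ln f'\<bar>\<close> is not small, and \<open>\<gamma> f = 1\<close> follows (\<open>growth_rate_eq_1\<close>).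
\<close>

section \<open>Moduli of continuity\<close>

lemma modulus_nonneg: "modulus_of_continuity \<omega> \<Longrightarrow> 0 \<le> t \<Longrightarrow> t \<le> 1 \<Longrightarrow> 0 \<le> \<omega> t"
  by (simp add: modulus_of_continuity_def)

lemma modulus_mono: "modulus_of_continuity \<omega> \<Longrightarrow> 0 \<le> s \<Longrightarrow> s \<le> t \<Longrightarrow> t \<le> 1 \<Longrightarrow> \<omega> s \<le> \<omega> t"
  by (auto simp: modulus_of_continuity_def mono_on_def)

lemma modulus_tendsto_0:
  assumes "modulus_of_continuity \<omega>"
    and "(u \<longlongrightarrow> 0) F" and "eventually (\<lambda>x. 0 \<le> u x \<and> u x \<le> 1) F"
  shows "((\<lambda>x. \<omega> (u x)) \<longlongrightarrow> 0) F"
proof -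
  have c: "continuous_on {0..1} \<omega>" and z: "\<omega> 0 = 0"
    using assms(1) by (auto simp: modulus_of_continuity_def)
  have "((\<lambda>x. \<omega> (u x)) \<longlongrightarrow> \<omega> 0) F"
    by (rule continuous_on_tendsto_compose[OF c assms(2)]) (use assms(3) in auto)
  then show ?thesis by (simp add: z)
qed

lemma modulus_of_nat_mult_le:
  assumes "modulus_of_continuity \<omega>" and "0 \<le> u" and "real n * u \<le> 1"
  shows "\<omega> (real n * u) \<le> real n * \<omega> u"
  using assms(3)
proof (induction n)
  case 0
  then show ?case using assms(1) by (simp add: modulus_of_continuity_def)
next
  case (Suc n)
  have "0 \<le> real n * u" using assms(2) by simp
  moreover have "real n * u + u \<le> 1" using Suc.prems by (simp add: algebra_simps)
  ultimately have le: "real n * u \<le> 1" "u \<le> 1" using assms(2) by linarith+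
  have "\<omega> (real (Suc n) * u) = \<omega> (real n * u + u)" by (simp add: algebra_simps)
  also have "\<dots> \<le> \<omega> (real n * u) + \<omega> u"
    using assms(1,2) le Suc.prems unfolding modulus_of_continuity_def
    by (auto simp: algebra_simps)
  finally show ?case using Suc.IH[OF le(1)] by (simp add: algebra_simps)
qed

text \<open>Subadditivity makes \<open>\<omega> t / t\<close> decreasing up to a factor \<open>2\<close>.\<close>

lemma modulus_ratio_le:
  assumes "modulus_of_continuity \<omega>" and "0 < t" and "t \<le> s" and "s \<le> 1"
  shows "\<omega> s \<le> 2 * (s / t) * \<omega> t"
proof -
  define m where "m = nat \<lceil>s / t\<rceil>"
  have st: "1 \<le> s / t" using assms by simp
  have m: "s / t \<le> real m" "real m \<le> 2 * (s / t)" "0 < m"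
    using st unfolding m_def by linarith+
  have "s / real m \<le> t" using m assms by (simp add: field_simps)
  moreover have "\<omega> (real m * (s / real m)) \<le> real m * \<omega> (s / real m)"
    by (rule modulus_of_nat_mult_le) (use assms m in auto)
  ultimately have "\<omega> s \<le> real m * \<omega> (s / real m)" using m by simp
  also have "\<dots> \<le> real m * \<omega> t"
    by (intro mult_left_mono modulus_mono[OF assms(1)]) (use assms m \<open>s / real m \<le> t\<close> in auto)
  also have "\<dots> \<le> 2 * (s / t) * \<omega> t"
    by (intro mult_right_mono m modulus_nonneg[OF assms(1)]) (use assms in auto)
  finally show ?thesis .
qed

text \<open>
  By subadditivity, \<open>\<omega> 1\<close> is at most a multiple of \<open>\<omega> t\<close>.
\<close>

lemma modulus_pos:
  assumes "modulus_of_continuity \<omega>" and "\<omega> 1 \<noteq> 0" and "0 < t" and "t \<le> 1"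
  shows "0 < \<omega> t"
proof -
  have "0 < \<omega> 1" using modulus_nonneg[OF assms(1), of 1] assms(2) by simp
  also have "\<omega> 1 \<le> 2 * (1 / t) * \<omega> t" by (rule modulus_ratio_le) (use assms in auto)
  finally show ?thesis using assms(3) by (simp add: zero_less_mult_iff zero_less_divide_iff)
qed

text \<open>
  The factor is the quotient \<open>\<omega> x / x\<^sup>\<alpha>\<close> at \<open>x = a / 2\<close>. For \<open>\<alpha> < 1\<close> this keeps \<open>\<omega>\<close> well above the
  identity near \<open>0\<close>.
\<close>

lemma modulus_ge_powr:
  assumes "modulus_of_continuity \<omega>" and "\<omega> 1 \<noteq> 0" and "0 < a" and "a < 1"
    and "antimono_on {0<..<a} (\<lambda>x. \<omega> x / x powr \<alpha>)"
  shows "\<exists>c>0. \<forall>t. 0 < t \<and> t \<le> a / 2 \<longrightarrow> c * t powr \<alpha> \<le> \<omega> t"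
proof (intro exI conjI allI impI)
  show "0 < \<omega> (a / 2) / (a / 2) powr \<alpha>"
    using modulus_pos[OF assms(1,2), of "a / 2"] assms by simp
  fix t assume t: "0 < t \<and> t \<le> a / 2"
  then have "\<omega> (a / 2) / (a / 2) powr \<alpha> \<le> \<omega> t / t powr \<alpha>"
    using assms by (intro monotone_onD[OF assms(5)]) auto
  then show "\<omega> (a / 2) / (a / 2) powr \<alpha> * t powr \<alpha> \<le> \<omega> t"
    using t by (simp add: pos_le_divide_eq)
qed

section \<open>Derivatives along orbits\<close>

lemma deriv01_eqI:
  assumes "(f has_real_derivative d) (at x within {0..1})" and "x \<in> {0..1}"
  shows "deriv01 f x = d"
  unfolding deriv01_def
  by (rule vector_derivative_within_closed_interval)
     (use assms in \<open>auto simp: has_real_derivative_iff_has_vector_derivative\<close>)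

lemma C1_on01I:
  assumes "\<And>x. x \<in> {0..1} \<Longrightarrow> (f has_real_derivative D x) (at x within {0..1})"
    and "continuous_on {0..1} D"
  shows "C1_on01 f"
proof -
  have "f differentiable_on {0..1}"
    using assms(1) unfolding differentiable_on_def by (meson real_differentiable_def)
  moreover have "continuous_on {0..1} (deriv01 f)"
    using assms by (subst continuous_on_cong[OF refl deriv01_eqI[OF assms(1)]]) auto
  ultimately show ?thesis by (simp add: C1_on01_def)
qed

lemma funpow_mem: "\<phi> ` S \<subseteq> S \<Longrightarrow> x \<in> S \<Longrightarrow> (\<phi> ^^ n) x \<in> S"
  by (induction n) auto

lemma has_real_derivative_funpow:
  assumes "\<And>x. x \<in> S \<Longrightarrow> (\<phi> has_real_derivative D x) (at x within S)"
    and "\<phi> ` S \<subseteq> S" and "x \<in> S"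
  shows "((\<phi> ^^ n) has_real_derivative (\<Prod>i<n. D ((\<phi> ^^ i) x))) (at x within S)"
proof (induction n)
  case 0
  then show ?case by (simp add: id_def)
next
  case (Suc n)
  have "(\<phi> has_real_derivative D ((\<phi> ^^ n) x)) (at ((\<phi> ^^ n) x) within (\<phi> ^^ n) ` S)"
    by (rule DERIV_subset[OF assms(1)]) (use funpow_mem[OF assms(2)] assms(3) in auto)
  from DERIV_image_chain[OF this Suc] show ?case by (simp add: mult.commute o_def)
qed

lemma deriv01_funpow_eq_prod:
  assumes "\<And>x. x \<in> {0..1} \<Longrightarrow> (\<phi> has_real_derivative D x) (at x within {0..1})"
    and "\<phi> ` {0..1} \<subseteq> {0..1}" and "x \<in> {0..1}"
  shows "deriv01 (\<phi> ^^ n) x = (\<Prod>i<n. D ((\<phi> ^^ i) x))"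
  by (rule deriv01_eqI[OF has_real_derivative_funpow[OF assms]]) (use assms(3) in auto)

text \<open>
  The compact set where \<open>ln D \<ge> \<delta>\<close> contains no fixed point of \<open>\<phi>\<close>. So \<open>\<phi>\<close> moves its points by at
  least some \<open>m > 0\<close>, and a large multiple of the displacement dominates \<open>ln D\<close> there.
\<close>

lemma ln_deriv_le_displacement:
  assumes "continuous_on {0..1} \<phi>" and "continuous_on {0..1} D"
    and "\<And>x. x \<in> {0..1} \<Longrightarrow> 0 < D x"
    and "\<And>x. x \<in> {0..1} \<Longrightarrow> \<phi> x = x \<Longrightarrow> D x = 1"
    and "0 < \<delta>"
  shows "\<exists>C\<ge>0. \<forall>x\<in>{0..1::real}. ln (D x) \<le> \<delta> + C * \<bar>\<phi> x - x\<bar>"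
proof -
  define S where "S = {x \<in> {0..1}. \<delta> \<le> ln (D x)}"
  have cl: "continuous_on {0..1} (\<lambda>x. ln (D x))"
    using assms(2,3) by (intro continuous_intros) (auto simp: less_imp_neq[symmetric])
  have "closed S" unfolding S_def
    by (rule continuous_on_closed_Collect_le) (use cl in auto)
  moreover have "{0..1} \<inter> S = S" by (auto simp: S_def)
  ultimately have cS: "compact S"
    using compact_Int_closed[of "{0..1}" S] by simp
  show ?thesis
  proof (cases "S = {}")
    case True
    then have "\<forall>x\<in>{0..1}. ln (D x) \<le> \<delta>" unfolding S_def by force
    then show ?thesis by (intro exI[of _ 0]) auto
  next
    case False
    have sub: "S \<subseteq> {0..1}" by (auto simp: S_def)
    obtain u where u: "u \<in> S" "\<And>x. x \<in> S \<Longrightarrow> ln (D x) \<le> ln (D u)"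
      using continuous_attains_sup[OF cS False continuous_on_subset[OF cl sub]] by auto
    have "continuous_on S (\<lambda>x. \<bar>\<phi> x - x\<bar>)"
      by (intro continuous_intros continuous_on_subset[OF assms(1) sub])
    then obtain v where v: "v \<in> S" "\<And>x. x \<in> S \<Longrightarrow> \<bar>\<phi> v - v\<bar> \<le> \<bar>\<phi> x - x\<bar>"
      using continuous_attains_inf[OF cS False, of "\<lambda>x. \<bar>\<phi> x - x\<bar>"] by auto
    have "\<phi> v \<noteq> v" using v(1) assms(4)[of v] assms(5) by (auto simp: S_def)
    then have m: "0 < \<bar>\<phi> v - v\<bar>" by simp
    have M: "0 < ln (D u)" using u(1) assms(5) by (auto simp: S_def)
    define C where "C = ln (D u) / \<bar>\<phi> v - v\<bar>"
    have C: "0 \<le> C" using m M by (simp add: C_def)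
    have "ln (D x) \<le> \<delta> + C * \<bar>\<phi> x - x\<bar>" if x: "x \<in> {0..1}" for x
    proof (cases "x \<in> S")
      case True
      have "ln (D x) \<le> ln (D u)" by (rule u(2)[OF True])
      also have "\<dots> = C * \<bar>\<phi> v - v\<bar>" using m by (simp add: C_def)
      also have "\<dots> \<le> C * \<bar>\<phi> x - x\<bar>" by (rule mult_left_mono[OF v(2)[OF True] C])
      finally show ?thesis using assms(5) by simp
    next
      case False
      then have "ln (D x) \<le> \<delta>" using x by (simp add: S_def)
      then show ?thesis using C by (simp add: add_increasing2)
    qed
    with C show ?thesis by blast
  qed
qed

text \<open>The displacements along an orbit all have the same sign, so their sum telescopes.\<close>

lemma prod_deriv_orbit_le:
  assumes "\<phi> ` {0..1} \<subseteq> {0..1}" and "\<And>x. x \<in> {0..1} \<Longrightarrow> 0 < D x"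
    and "\<bar>\<sigma>\<bar> = 1" and "\<And>x. x \<in> {0..1} \<Longrightarrow> 0 \<le> \<sigma> * (\<phi> x - x)"
    and "0 \<le> C" and "\<And>x. x \<in> {0..1} \<Longrightarrow> ln (D x) \<le> \<delta> + C * \<bar>\<phi> x - x\<bar>"
    and "x \<in> {0..1::real}"
  shows "(\<Prod>i<n. D ((\<phi> ^^ i) x)) \<le> exp (real n * \<delta> + C)"
proof -
  have mem: "(\<phi> ^^ i) x \<in> {0..1}" for i by (rule funpow_mem[OF assms(1,7)])
  have abs: "\<bar>\<phi> y - y\<bar> = \<sigma> * (\<phi> y - y)" if "y \<in> {0..1}" for y
    using assms(4)[OF that] assms(3) by (metis abs_mult abs_of_nonneg mult_1)
  have "(\<Sum>i<n. \<bar>\<phi> ((\<phi> ^^ i) x) - (\<phi> ^^ i) x\<bar>) = \<sigma> * (\<Sum>i<n. (\<phi> ^^ Suc i) x - (\<phi> ^^ i) x)"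
    using abs[OF mem] by (simp add: sum_distrib_left)
  also have "(\<Sum>i<n. (\<phi> ^^ Suc i) x - (\<phi> ^^ i) x) = (\<phi> ^^ n) x - x"
    using sum_lessThan_telescope[of "\<lambda>i. (\<phi> ^^ i) x" n] by simp
  also have "\<sigma> * ((\<phi> ^^ n) x - x) \<le> \<bar>\<sigma>\<bar> * \<bar>(\<phi> ^^ n) x - x\<bar>"
    by (metis abs_ge_self abs_mult)
  also have "\<dots> \<le> 1" using mem[of n] assms(3,7) by auto
  finally have tele: "(\<Sum>i<n. \<bar>\<phi> ((\<phi> ^^ i) x) - (\<phi> ^^ i) x\<bar>) \<le> 1" .
  have "(\<Prod>i<n. D ((\<phi> ^^ i) x)) = exp (\<Sum>i<n. ln (D ((\<phi> ^^ i) x)))"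
    using assms(2)[OF mem] by (simp add: exp_sum)
  also have "(\<Sum>i<n. ln (D ((\<phi> ^^ i) x))) \<le> (\<Sum>i<n. \<delta> + C * \<bar>\<phi> ((\<phi> ^^ i) x) - (\<phi> ^^ i) x\<bar>)"
    by (intro sum_mono assms(6) mem)
  also have "\<dots> = real n * \<delta> + C * (\<Sum>i<n. \<bar>\<phi> ((\<phi> ^^ i) x) - (\<phi> ^^ i) x\<bar>)"
    by (simp add: sum.distrib sum_distrib_left)
  also have "\<dots> \<le> real n * \<delta> + C" using mult_left_mono[OF tele assms(5)] by simp
  finally show ?thesis by simp
qed

section \<open>Diffeomorphisms of the interval\<close>

locale interval_diffeo =
  fixes f D :: "real \<Rightarrow> real"
  assumes deriv: "x \<in> {0..1} \<Longrightarrow> (f has_real_derivative D x) (at x within {0..1})"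
    and cont_D: "continuous_on {0..1} D"
    and D_pos: "x \<in> {0..1} \<Longrightarrow> 0 < D x"
    and f_0: "f 0 = 0" and f_1: "f 1 = 1"
begin

lemma cont_f: "continuous_on {0..1} f"
  using deriv by (meson DERIV_continuous continuous_on_eq_continuous_within)

lemma strict_mono: "0 \<le> x \<Longrightarrow> x < y \<Longrightarrow> y \<le> 1 \<Longrightarrow> f x < f y"
proof -
  assume xy: "0 \<le> x" "x < y" "y \<le> 1"
  have "(f has_real_derivative D z) (at z)" if "x < z" "z < y" for z
    using deriv[of z] that xy by (metis at_within_Icc_at atLeastAtMost_iff less_imp_le order_le_less_trans order_less_le_trans)
  then have "\<And>z. x < z \<Longrightarrow> z < y \<Longrightarrow> \<exists>d. (f has_real_derivative d) (at z) \<and> 0 < d"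
    using D_pos xy by (meson atLeastAtMost_iff less_imp_le order_trans)
  then show "f x < f y"
    using DERIV_pos_imp_increasing_open[OF xy(2)] continuous_on_subset[OF cont_f, of "{x..y}"] xy by auto
qed

lemma mono: "0 \<le> x \<Longrightarrow> x \<le> y \<Longrightarrow> y \<le> 1 \<Longrightarrow> f x \<le> f y"
  using strict_mono[of x y] by (cases "x = y") auto

lemma inj: "inj_on f {0..1}"
  by (rule inj_onI) (metis atLeastAtMost_iff linorder_neqE_linordered_idom order_less_irrefl strict_mono)

lemma image: "f ` {0..1} = {0..1}"
proof
  show "f ` {0..1} \<subseteq> {0..1}" using mono[of 0] mono[of _ 1] f_0 f_1 by auto
  show "{0..1} \<subseteq> f ` {0..1}"
  proof
    fix y :: real assume "y \<in> {0..1}"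
    then show "y \<in> f ` {0..1}" using IVT'[of f 0 y 1] cont_f f_0 f_1 by auto
  qed
qed

lemma bij: "bij_betw f {0..1} {0..1}"
  using inj image by (simp add: bij_betw_def)

lemma inv_mem: "y \<in> {0..1} \<Longrightarrow> inv01 f y \<in> {0..1}"
  unfolding inv01_def using image inv_into_into by metis

lemma f_inv: "y \<in> {0..1} \<Longrightarrow> f (inv01 f y) = y"
  unfolding inv01_def using image f_inv_into_f by metis

lemma inv_f: "x \<in> {0..1} \<Longrightarrow> inv01 f (f x) = x"
  unfolding inv01_def using inj inv_into_f_f by metis

lemma cont_inv: "continuous_on {0..1} (inv01 f)"
  using continuous_on_inv[OF cont_f, of "inv01 f"] inv_f image by auto

text \<open>
  The difference quotients of the inverse are the reciprocals of those of \<open>f\<close>, evaluated at points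
  that tend to the preimage of \<open>y\<close> because the inverse is continuous. All limits are taken within
  \<open>[0,1]\<close>, so the end points are covered.
\<close>

lemma deriv_inv:
  assumes y: "y \<in> {0..1}"
  shows "(inv01 f has_real_derivative inverse (D (inv01 f y))) (at y within {0..1})"
proof -
  have lim: "filterlim (inv01 f) (at (inv01 f y) within {0..1}) (at y within {0..1})"
    unfolding filterlim_at
  proof
    show "(inv01 f \<longlongrightarrow> inv01 f y) (at y within {0..1})"
      using cont_inv y by (simp add: continuous_on_def)
    show "\<forall>\<^sub>F x in at y within {0..1}. inv01 f x \<in> {0..1} \<and> inv01 f x \<noteq> inv01 f y"
      unfolding eventually_at_filter by (rule always_eventually) (metis f_inv inv_mem y)
  qed
  have "((\<lambda>u. (f u - f (inv01 f y)) / (u - inv01 f y)) \<longlongrightarrow> D (inv01 f y)) (at (inv01 f y) within {0..1})"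
    using deriv[OF inv_mem[OF y]] by (simp add: has_field_derivative_iff)
  from filterlim_compose[OF this lim]
  have "((\<lambda>z. (f (inv01 f z) - y) / (inv01 f z - inv01 f y)) \<longlongrightarrow> D (inv01 f y)) (at y within {0..1})"
    by (simp add: f_inv[OF y])
  from tendsto_inverse[OF this] D_pos[OF inv_mem[OF y]]
  have *: "((\<lambda>z. (inv01 f z - inv01 f y) / (f (inv01 f z) - y)) \<longlongrightarrow> inverse (D (inv01 f y))) (at y within {0..1})"
    by (simp add: inverse_eq_divide)
  have "((\<lambda>z. (inv01 f z - inv01 f y) / (z - y)) \<longlongrightarrow> inverse (D (inv01 f y))) (at y within {0..1})"
    by (rule Lim_transform_eventually[OF *])
       (auto simp: eventually_at_filter f_inv intro: always_eventually)
  then show ?thesis by (simp add: has_field_derivative_iff)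
qed

lemma cont_deriv_inv: "continuous_on {0..1} (\<lambda>y. inverse (D (inv01 f y)))"
  by (intro continuous_on_inverse continuous_on_compose2[OF cont_D cont_inv])
     (use inv_mem D_pos in \<open>auto simp: less_imp_neq[symmetric]\<close>)

lemma in_Diff0: "f \<in> Diff0"
  unfolding Diff0_def
  using bij f_0 f_1 C1_on01I[OF deriv cont_D] C1_on01I[OF deriv_inv cont_deriv_inv] by auto

lemma deriv01_eq: "x \<in> {0..1} \<Longrightarrow> deriv01 f x = D x"
  by (rule deriv01_eqI[OF deriv])

lemma deriv01_funpow: "x \<in> {0..1} \<Longrightarrow> deriv01 (f ^^ n) x = (\<Prod>i<n. D ((f ^^ i) x))"
  by (rule deriv01_funpow_eq_prod[OF deriv]) (use image in auto)

lemma bdd_above_deriv01_funpow: "bdd_above ((\<lambda>x. \<bar>deriv01 (f ^^ n) x\<bar>) ` {0..1})"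
proof -
  have ci: "continuous_on {0..1} (f ^^ i)" for i
    unfolding continuous_on_eq_continuous_within
    using DERIV_continuous[OF has_real_derivative_funpow[OF deriv]] image by blast
  have "continuous_on {0..1} (\<lambda>x. \<bar>\<Prod>i<n. D ((f ^^ i) x)\<bar>)"
    by (intro continuous_intros continuous_on_compose2[OF cont_D ci])
       (use funpow_mem[of f "{0..1}"] image in auto)
  then have "continuous_on {0..1} (\<lambda>x. \<bar>deriv01 (f ^^ n) x\<bar>)"
    by (subst continuous_on_cong[OF refl]) (simp_all add: deriv01_funpow)
  then show ?thesis
    by (intro bounded_imp_bdd_above compact_imp_bounded compact_continuous_image) auto
qed

lemma prod_deriv_le_growth_seq:
  assumes "x \<in> {0..1}"
  shows "(\<Prod>i<n. D ((f ^^ i) x)) \<le> growth_seq f n"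
proof -
  have "(\<Prod>i<n. D ((f ^^ i) x)) \<le> \<bar>deriv01 (f ^^ n) x\<bar>"
    using deriv01_funpow[OF assms] by simp
  also have "\<dots> \<le> supnorm01 (deriv01 (f ^^ n))"
    unfolding supnorm01_def by (rule cSUP_upper[OF assms bdd_above_deriv01_funpow])
  also have "\<dots> \<le> growth_seq f n" by (simp add: growth_seq_def)
  finally show ?thesis .
qed

text \<open>
  Both \<open>f\<close> and its inverse have only the end points as fixed points, with derivative \<open>1\<close> there. So
  their derivatives along orbits are at most \<open>exp (n \<delta> + C)\<close>, for each \<open>\<delta> > 0\<close> and uniformly in the
  starting point. The \<open>n\<close>-th roots are squeezed between \<open>1\<close> and numbers close to \<open>exp \<delta>\<close>.
\<close>

lemma growth_rate_eq_1:
  assumes "D 0 = 1" and "D 1 = 1" and below: "\<And>x. 0 < x \<Longrightarrow> x < 1 \<Longrightarrow> f x < x"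
  shows "growth_rate f = 1"
proof -
  have le: "f x \<le> x" if "x \<in> {0..1}" for x
    using below[of x] that f_0 f_1 by (cases "x = 0 \<or> x = 1") auto
  have fix1: "D x = 1" if "x \<in> {0..1}" "f x = x" for x
    using below[of x] that assms(1,2) by (cases "x = 0 \<or> x = 1") auto
  have bound: "\<exists>C. \<forall>n. growth_seq f n \<le> exp (real n * \<delta> + C)" if \<delta>: "0 < \<delta>" for \<delta>
  proof -
    obtain C1 where C1: "0 \<le> C1" "\<forall>x\<in>{0..1}. ln (D x) \<le> \<delta> + C1 * \<bar>f x - x\<bar>"
      using ln_deriv_le_displacement[OF cont_f cont_D D_pos fix1 \<delta>] by blast
    obtain C2 where C2: "0 \<le> C2"
        "\<forall>x\<in>{0..1}. ln (inverse (D (inv01 f x))) \<le> \<delta> + C2 * \<bar>inv01 f x - x\<bar>"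
      using ln_deriv_le_displacement[OF cont_inv cont_deriv_inv _ _ \<delta>] D_pos inv_mem fix1 f_inv
      by (smt (verit, ccfv_threshold) inverse_1 positive_imp_inverse_positive)
    have 1: "supnorm01 (deriv01 (f ^^ n)) \<le> exp (real n * \<delta> + C1)" for n
      unfolding supnorm01_def
    proof (rule cSUP_least)
      fix x :: real assume x: "x \<in> {0..1}"
      have m: "(f ^^ i) x \<in> {0..1}" for i using funpow_mem[of f "{0..1}"] image x by blast
      have "(\<Prod>i<n. D ((f ^^ i) x)) \<le> exp (real n * \<delta> + C1)"
        by (rule prod_deriv_orbit_le[where \<sigma> = "-1"]) (use C1 image D_pos le x in auto)
      moreover have "0 \<le> (\<Prod>i<n. D ((f ^^ i) x))" by (intro prod_nonneg) (use m D_pos in \<open>auto intro: less_imp_le\<close>)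
      ultimately show "\<bar>deriv01 (f ^^ n) x\<bar> \<le> exp (real n * \<delta> + C1)"
        by (simp add: deriv01_funpow[OF x])
    qed auto
    have 2: "supnorm01 (deriv01 (inv01 f ^^ n)) \<le> exp (real n * \<delta> + C2)" for n
      unfolding supnorm01_def
    proof (rule cSUP_least)
      fix x :: real assume x: "x \<in> {0..1}"
      have im: "inv01 f ` {0..1} \<subseteq> {0..1}" using inv_mem by auto
      have m: "(inv01 f ^^ i) x \<in> {0..1}" for i using funpow_mem[OF im x] .
      have "(\<Prod>i<n. inverse (D (inv01 f ((inv01 f ^^ i) x)))) \<le> exp (real n * \<delta> + C2)"
        by (rule prod_deriv_orbit_le[where \<sigma> = 1 and D = "\<lambda>y. inverse (D (inv01 f y))"])
           (use C2 im D_pos[OF inv_mem] le[OF inv_mem] f_inv x in auto)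
      moreover have "0 \<le> (\<Prod>i<n. inverse (D (inv01 f ((inv01 f ^^ i) x))))"
        by (intro prod_nonneg) (use D_pos[OF inv_mem[OF m]] in \<open>auto intro: less_imp_le\<close>)
      ultimately show "\<bar>deriv01 (inv01 f ^^ n) x\<bar> \<le> exp (real n * \<delta> + C2)"
        using deriv01_funpow_eq_prod[OF deriv_inv im x] by simp
    qed auto
    have "growth_seq f n \<le> exp (real n * \<delta> + max C1 C2)" for n
      unfolding growth_seq_def using 1[of n] 2[of n]
      by (intro max.boundedI) (auto elim!: order_trans)
    then show ?thesis by blast
  qed
  \<comment> \<open>The end point \<open>0\<close> is fixed with derivative \<open>1\<close>.\<close>
  have ge1: "1 \<le> growth_seq f n" for n
  proof -
    have "(f ^^ i) 0 = 0" for i by (induction i) (auto simp: f_0)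
    then show ?thesis using prod_deriv_le_growth_seq[of 0 n] assms(1) by simp
  qed
  have "(\<lambda>n. root n (growth_seq f n)) \<longlonglongrightarrow> 1"
  proof (rule LIMSEQ_I)
    fix r :: real assume r: "0 < r"
    \<comment> \<open>Half of the exponent \<open>ln (1 + r)\<close> is left to absorb the constant \<open>C\<close>.\<close>
    define \<delta> where "\<delta> = ln (1 + r) / 2"
    have \<delta>: "0 < \<delta>" using r by (simp add: \<delta>_def)
    obtain C where C: "\<And>n. growth_seq f n \<le> exp (real n * \<delta> + C)" using bound[OF \<delta>] by blast
    obtain N where N: "C / \<delta> < real N" using reals_Archimedean2 by blast
    have "norm (root n (growth_seq f n) - 1) < r" if n: "n \<ge> Suc N" for n
    proof -
      have "C < real N * \<delta>" using N \<delta> by (simp add: pos_divide_less_eq)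
      also have "\<dots> \<le> real n * \<delta>" using n \<delta> by (intro mult_right_mono) auto
      finally have "growth_seq f n < exp (real n * (2 * \<delta>))"
        using C[of n] by (smt (verit) exp_less_mono distrib_left mult_2)
      also have "\<dots> = (1 + r) ^ n"
        using r by (simp add: \<delta>_def exp_of_nat_mult)
      finally have "root n (growth_seq f n) < root n ((1 + r) ^ n)"
        using n by (intro real_root_less_mono) auto
      then have "root n (growth_seq f n) < 1 + r" using n r by (simp add: real_root_power_cancel)
      moreover have "1 \<le> root n (growth_seq f n)" using ge1[of n] n by simp
      ultimately show ?thesis by simp
    qed
    then show "\<exists>no. \<forall>n\<ge>no. norm (root n (growth_seq f n) - 1) < r" by blast
  qed
  then show ?thesis unfolding growth_rate_def by (rule limI)
qed

end

section \<open>Interpolation on intervals accumulating at zero\<close>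

text \<open>
  The nodes \<open>z k\<close> cut \<open>(0,1]\<close> into intervals. On the \<open>k\<close>-th interval \<open>[z (k + 1), z k]\<close> the function
  \<open>slope\<close> below joins the values \<open>d (k + 1)\<close> and \<open>d k\<close> linearly and adds a parabola that vanishes at
  both ends. The parabola \<open>6 s (1 - s)\<close> has integral \<open>1\<close> over \<open>[0,1]\<close>, so \<open>c k\<close> shifts the mean.
\<close>

locale interpolation =
  fixes z d c :: "nat \<Rightarrow> real"
  assumes z_0: "z 0 = 1" and z_Suc_less: "z (Suc k) < z k" and z_lim: "z \<longlonglongrightarrow> 0"
begin

definition len :: "nat \<Rightarrow> real" where "len k = z k - z (Suc k)"

definition piece :: "nat \<Rightarrow> real \<Rightarrow> real" where
  "piece k x = (let s = (x - z (Suc k)) / len k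
     in d (Suc k) * (1 - s) + d k * s + 6 * c k * s * (1 - s))"

text \<open>
  The \<open>LEAST\<close> picks the interval that contains \<open>x\<close>. The value \<open>1\<close> at \<open>0\<close> is the limit of the values
  \<open>d k\<close> in the application.
\<close>

definition slope :: "real \<Rightarrow> real" where
  "slope x = (if x \<le> 0 then 1 else piece (LEAST k. z (Suc k) < x) x)"

lemma z_less: "i < j \<Longrightarrow> z j < z i"
  using lift_Suc_mono_less[of "\<lambda>k. - z k" i j] z_Suc_less by simp

lemma z_le: "i \<le> j \<Longrightarrow> z j \<le> z i"
  using z_less[of i j] by (cases "i = j") auto

lemma z_pos: "0 < z k"
proof -
  have "0 \<le> z (Suc k)"
    by (rule LIMSEQ_le_const2[OF z_lim]) (use z_le in blast)
  with z_Suc_less[of k] show ?thesis by simp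
qed

lemma len_pos: "0 < len k"
  using z_Suc_less by (simp add: len_def)

lemma len_le_1: "len k \<le> 1"
  using z_le[of 0 k] z_pos[of "Suc k"] z_0 by (simp add: len_def)

lemma interval_cases:
  assumes "0 < x" and "x \<le> 1"
  obtains k where "z (Suc k) < x" and "x \<le> z k"
proof -
  have "eventually (\<lambda>k. z k < x) sequentially"
    using order_tendstoD(2)[OF z_lim assms(1)] .
  then obtain n where n: "z n < x" by (auto simp: eventually_sequentially)
  define m where "m = (LEAST n. z n < x)"
  have m: "z m < x" unfolding m_def by (rule LeastI[of "\<lambda>n. z n < x", OF n])
  obtain k where k: "m = Suc k" using m z_0 assms(2) by (cases m) auto
  then have "\<not> z k < x" using not_less_Least[of k "\<lambda>n. z n < x"] by (simp add: m_def)
  then show thesis using that m k by (simp add: not_less)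
qed

lemma slope_eq_piece:
  assumes "z (Suc k) < x" and "x \<le> z k"
  shows "slope x = piece k x"
proof -
  have "(LEAST k. z (Suc k) < x) = k"
  proof (rule Least_equality)
    fix i assume "z (Suc i) < x"
    then show "k \<le> i" using assms(2) z_le[of "Suc i" k] by (cases "k \<le> i") auto
  qed (rule assms)
  moreover have "0 < x" using z_pos[of "Suc k"] assms(1) by simp
  ultimately show ?thesis by (simp add: slope_def)
qed

lemma slope_node: "slope (z k) = d k"
  using slope_eq_piece[of k "z k"] z_Suc_less[of k] len_pos[of k]
  by (simp add: piece_def Let_def flip: len_def)

lemma slope_0: "slope 0 = 1"
  by (simp add: slope_def)

lemma slope_eq_piece': "z (Suc k) \<le> x \<Longrightarrow> x \<le> z k \<Longrightarrow> slope x = piece k x"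
  using slope_eq_piece[of k x] slope_node[of "Suc k"]
  by (cases "x = z (Suc k)") (auto simp: piece_def)

text \<open>
  The linear part is a convex combination of the end values, and \<open>6 s (1 - s) \<le> 3 / 2\<close>.
\<close>

lemma piece_bounds:
  assumes "z (Suc k) \<le> x" and "x \<le> z k"
    and "\<bar>d k - 1\<bar> \<le> e" and "\<bar>d (Suc k) - 1\<bar> \<le> e" and "\<bar>c k\<bar> \<le> e'"
  shows "\<bar>piece k x - 1\<bar> \<le> e + 3 / 2 * e'"
proof -
  define s where "s = (x - z (Suc k)) / len k"
  have s: "0 \<le> s" "s \<le> 1" using assms(1,2) len_pos[of k] by (auto simp: s_def len_def)
  have ss: "0 \<le> s * (1 - s)" "s * (1 - s) \<le> 1 / 4"
    using s sum_squares_ge_zero[of "s - 1/2" 0] by (simp, simp add: algebra_simps)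
  have "piece k x - 1 = (d (Suc k) - 1) * (1 - s) + (d k - 1) * s + c k * (6 * (s * (1 - s)))"
    by (simp add: piece_def Let_def algebra_simps flip: s_def)
  also have "\<bar>\<dots>\<bar> \<le> \<bar>d (Suc k) - 1\<bar> * (1 - s) + \<bar>d k - 1\<bar> * s + \<bar>c k\<bar> * (6 * (s * (1 - s)))"
    using s ss by (intro order_trans[OF abs_triangle_ineq] add_mono) (auto simp: abs_mult)
  also have "\<dots> \<le> e * (1 - s) + e * s + e' * (6 * (1 / 4))"
    using s ss assms(3-5) by (intro add_mono mult_mono mult_right_mono) auto
  finally show ?thesis by (simp add: algebra_simps)
qed

lemma piece_lipschitz:
  assumes "z (Suc k) \<le> x" and "x \<le> z k" and "z (Suc k) \<le> y" and "y \<le> z k"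
    and "\<bar>d k - 1\<bar> \<le> e" and "\<bar>d (Suc k) - 1\<bar> \<le> e" and "\<bar>c k\<bar> \<le> e'"
  shows "\<bar>piece k x - piece k y\<bar> \<le> (2 * e + 6 * e') * (\<bar>x - y\<bar> / len k)"
proof -
  define s where "s = (x - z (Suc k)) / len k"
  define t where "t = (y - z (Suc k)) / len k"
  have st: "0 \<le> s" "s \<le> 1" "0 \<le> t" "t \<le> 1"
    using assms(1-4) len_pos[of k] by (auto simp: s_def t_def len_def)
  have "piece k x - piece k y = (d k - d (Suc k) + 6 * c k * (1 - s - t)) * (s - t)"
    unfolding piece_def Let_def s_def[symmetric] t_def[symmetric] by (simp add: algebra_simps)
  moreover have "s - t = (x - y) / len k"
    by (simp add: s_def t_def diff_divide_distrib)
  ultimately have eq: "\<bar>piece k x - piece k y\<bar>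
      = \<bar>d k - d (Suc k) + 6 * c k * (1 - s - t)\<bar> * (\<bar>x - y\<bar> / len k)"
    using len_pos[of k] by (simp add: abs_mult)
  have "\<bar>6 * c k * (1 - s - t)\<bar> \<le> 6 * e'"
    using mult_mono[OF assms(7), of "\<bar>1 - s - t\<bar>" 1] st assms(7) by (simp add: abs_mult)
  then have "\<bar>d k - d (Suc k) + 6 * c k * (1 - s - t)\<bar> \<le> 2 * e + 6 * e'"
    using assms(5,6) by linarith
  then show ?thesis unfolding eq using len_pos[of k] by (intro mult_right_mono) auto
qed

lemma integral_piece:
  assumes "z (Suc k) \<le> x" and "x \<le> z k"
  defines "s \<equiv> (x - z (Suc k)) / len k"
  shows "(slope has_integral len k * (d (Suc k) * (s - s\<^sup>2 / 2) + d k * (s\<^sup>2 / 2)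
            + c k * (3 * s\<^sup>2 - 2 * s ^ 3))) {z (Suc k)..x}"
proof -
  define S where "S u = (u - z (Suc k)) / len k" for u
  define H where "H u = len k * (d (Suc k) * (S u - (S u)\<^sup>2 / 2) + d k * ((S u)\<^sup>2 / 2)
            + c k * (3 * (S u)\<^sup>2 - 2 * (S u) ^ 3))" for u
  have "(H has_vector_derivative piece k u) (at u within {z (Suc k)..x})" for u
  proof -
    have S: "(S has_real_derivative 1 / len k) (at u within {z (Suc k)..x})"
      unfolding S_def using len_pos[of k] by (auto intro!: derivative_eq_intros)
    have "((\<lambda>t. len k * (d (Suc k) * (t - t\<^sup>2 / 2) + d k * (t\<^sup>2 / 2) + c k * (3 * t\<^sup>2 - 2 * t ^ 3)))
        has_real_derivative len k * (d (Suc k) * (1 - S u) + d k * S u + c k * (6 * S u - 6 * (S u)\<^sup>2)))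
        (at (S u))"
      by (auto intro!: derivative_eq_intros)
    from DERIV_chain2[OF this S]
    have "(H has_real_derivative len k * (d (Suc k) * (1 - S u) + d k * S u + c k * (6 * S u - 6 * (S u)\<^sup>2))
        * (1 / len k)) (at u within {z (Suc k)..x})"
      unfolding H_def .
    moreover have "len k * (d (Suc k) * (1 - S u) + d k * S u + c k * (6 * S u - 6 * (S u)\<^sup>2)) * (1 / len k)
      = piece k u"
      using len_pos[of k] unfolding piece_def Let_def S_def[symmetric]
      by (simp add: algebra_simps power2_eq_square)
    ultimately show ?thesis by (simp add: has_real_derivative_iff_has_vector_derivative)
  qed
  then have "(piece k has_integral H x - H (z (Suc k))) {z (Suc k)..x}"
    by (intro fundamental_theorem_of_calculus) (use assms in auto)
  moreover have "H (z (Suc k)) = 0" by (simp add: H_def S_def)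
  ultimately have "(piece k has_integral H x) {z (Suc k)..x}" by simp
  then have "(slope has_integral H x) {z (Suc k)..x}"
    by (rule has_integral_eq[rotated]) (use assms in \<open>auto intro!: slope_eq_piece'[symmetric]\<close>)
  then show ?thesis by (simp add: H_def S_def s_def)
qed

text \<open>
  For two points of one interval \<open>k\<close> the Lipschitz constant is \<open>O(\<omega> (len k) / len k)\<close>, and this is at
  most \<open>O(\<omega> t / t)\<close> for their distance \<open>t \<le> len k\<close>. In general \<open>x > y\<close> are compared through the first
  node \<open>q\<close> below \<open>x\<close>. If \<open>y\<close> is beyond the interval next to \<open>q\<close>, then that whole interval lies between
  \<open>x\<close> and \<open>y\<close>, and the values at \<open>q\<close> and \<open>y\<close> differ from \<open>1\<close> by \<open>O(\<omega>)\<close> of its length, because the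
  lengths decrease towards \<open>0\<close>.
\<close>

lemma slope_modulus:
  assumes mod: "modulus_of_continuity \<omega>" and C: "0 \<le> C"
    and len_Suc: "\<And>k. len (Suc k) \<le> len k"
    and d: "\<And>k. \<bar>d k - 1\<bar> \<le> C * \<omega> (len k)" and d': "\<And>k. \<bar>d (Suc k) - 1\<bar> \<le> C * \<omega> (len k)"
    and c: "\<And>k. \<bar>c k\<bar> \<le> C * \<omega> (len k)"
    and xy: "x \<in> {0..1}" "y \<in> {0..1}"
  shows "\<bar>slope x - slope y\<bar> \<le> 32 * C * \<omega> \<bar>x - y\<bar>"
proof -
  have w_nonneg: "0 \<le> C * \<omega> t" if "0 \<le> t" "t \<le> 1" for t
    using modulus_nonneg[OF mod] C that by simp
  have w_mono: "C * \<omega> s \<le> C * \<omega> t" if "0 \<le> s" "s \<le> t" "t \<le> 1" for s t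
    using modulus_mono[OF mod] C that by (simp add: mult_left_mono)
  have len_mono: "len j \<le> len i" if "i \<le> j" for i j
    using that len_Suc lift_Suc_antimono_le[of len] by blast
  \<comment> \<open>Everything to the left of \<open>z k\<close> lies in intervals that are no longer than the \<open>k\<close>-th one.\<close>
  have near1: "\<bar>slope x - 1\<bar> \<le> 3 * C * \<omega> (len k)" if x: "0 \<le> x" "x \<le> z k" for x k
  proof (cases "x = 0")
    case True
    then show ?thesis using w_nonneg[of "len k"] len_pos[of k] len_le_1[of k] by (simp add: slope_0)
  next
    case False
    then obtain j where j: "z (Suc j) < x" "x \<le> z j"
      using interval_cases[of x] x z_le[of 0 k] z_0 by auto
    have kj: "k \<le> j"
      using j(1) x(2) z_le[of "Suc j" k] by (cases "k \<le> j") auto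
    have "\<bar>slope x - 1\<bar> \<le> C * \<omega> (len j) + 3 / 2 * (C * \<omega> (len j))"
      unfolding slope_eq_piece[OF j] by (rule piece_bounds) (use j d d' c in auto)
    also have "\<dots> \<le> 3 * (C * \<omega> (len j))"
      using w_nonneg[of "len j"] len_pos[of j] len_le_1[of j] by simp
    also have "\<dots> \<le> 3 * (C * \<omega> (len k))"
      using w_mono[OF _ len_mono[OF kj]] len_pos[of j] len_le_1[of k] by simp
    finally show ?thesis by simp
  qed
  have same: "\<bar>slope x - slope y\<bar> \<le> 16 * C * \<omega> (x - y)"
    if "z (Suc k) \<le> y" "y \<le> x" "x \<le> z k" for x y k
  proof (cases "x = y")
    case True
    then show ?thesis using w_nonneg[of 0] by simp
  next
    case False
    have L: "\<omega> (len k) \<le> 2 * (len k / (x - y)) * \<omega> (x - y)"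
      by (rule modulus_ratio_le[OF mod]) (use that False len_le_1[of k] in \<open>auto simp: len_def\<close>)
    have "\<bar>slope x - slope y\<bar> = \<bar>piece k x - piece k y\<bar>"
      using slope_eq_piece'[of k x] slope_eq_piece'[of k y] that by simp
    also have "\<dots> \<le> (2 * (C * \<omega> (len k)) + 6 * (C * \<omega> (len k))) * (\<bar>x - y\<bar> / len k)"
      by (rule piece_lipschitz) (use that d d' c in auto)
    also have "\<dots> = 8 * C * ((x - y) / len k) * \<omega> (len k)" using that by simp
    also have "\<dots> \<le> 8 * C * ((x - y) / len k) * (2 * (len k / (x - y)) * \<omega> (x - y))"
      using that C len_pos[of k] by (intro mult_left_mono[OF L]) auto
    also have "\<dots> = 16 * C * \<omega> (x - y)" using False len_pos[of k] by simp
    finally show ?thesis .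
  qed
  have main: "\<bar>slope x - slope y\<bar> \<le> 32 * C * \<omega> (x - y)" if xy: "0 \<le> y" "y < x" "x \<le> 1" for x y
  proof -
    obtain i where i: "z (Suc i) < x" "x \<le> z i" using interval_cases[of x] xy by auto
    define q where "q = z (Suc i)"
    consider "q \<le> y" | "z (Suc (Suc i)) \<le> y" "y < q" | "y < z (Suc (Suc i))" "y < q"
      unfolding q_def using z_Suc_less[of "Suc i"] by linarith
    then show ?thesis
    proof cases
      case 1
      then show ?thesis
        using same[of i y x] i xy w_nonneg[of "x - y"] by (simp add: q_def)
    next
      case 2
      have "\<bar>slope x - slope q\<bar> \<le> 16 * (C * \<omega> (x - q))" using same[of i q x] i by (simp add: q_def)
      also have "\<dots> \<le> 16 * (C * \<omega> (x - y))" using w_mono[of "x - q" "x - y"] 2 i xy by (simp add: q_def)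
      finally have A: "\<bar>slope x - slope q\<bar> \<le> 16 * (C * \<omega> (x - y))" .
      have "\<bar>slope q - slope y\<bar> \<le> 16 * (C * \<omega> (q - y))" using same[of "Suc i" y q] 2 by (simp add: q_def)
      also have "\<dots> \<le> 16 * (C * \<omega> (x - y))" using w_mono[of "q - y" "x - y"] 2 i xy by (simp add: q_def)
      finally show ?thesis using A by linarith
    next
      case 3
      have "\<bar>slope x - slope q\<bar> \<le> 16 * (C * \<omega> (x - q))" using same[of i q x] i by (simp add: q_def)
      also have "\<dots> \<le> 16 * (C * \<omega> (x - y))" using w_mono[of "x - q" "x - y"] 3 i xy by (simp add: q_def)
      finally have A: "\<bar>slope x - slope q\<bar> \<le> 16 * (C * \<omega> (x - y))" .
      have "C * \<omega> (len (Suc i)) \<le> C * \<omega> (x - y)"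
        using w_mono[of "len (Suc i)" "x - y"] 3 i xy len_pos[of "Suc i"] by (simp add: q_def len_def)
      moreover have "\<bar>slope q - 1\<bar> \<le> 3 * (C * \<omega> (len (Suc i)))"
        using near1[of q "Suc i"] z_pos[of "Suc i"] by (simp add: q_def)
      moreover have "\<bar>slope y - 1\<bar> \<le> 3 * (C * \<omega> (len (Suc i)))"
        using near1[of y "Suc i"] 3 xy by (simp add: q_def)
      ultimately show ?thesis using A w_nonneg[of "x - y"] xy by linarith
    qed
  qed
  show ?thesis
  proof (cases x y rule: linorder_cases)
    case less
    then show ?thesis using main[of x y] xy by (simp add: abs_minus_commute)
  next
    case equal
    then show ?thesis using w_nonneg[of 0] by simp
  next
    case greater
    then show ?thesis using main[of y x] xy by simp
  qed
qed

end

lemma continuous_on_if_modulus: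
  assumes "modulus_of_continuity \<omega>"
    and "\<And>x y. x \<in> {0..1} \<Longrightarrow> y \<in> {0..1} \<Longrightarrow> \<bar>g x - g y\<bar> \<le> K * \<omega> \<bar>x - y\<bar>"
  shows "continuous_on {0..1} g"
  unfolding continuous_on_def
proof
  fix x :: real assume x: "x \<in> {0..1}"
  have near: "\<forall>\<^sub>F y in at x within {0..1}. y \<in> {0..1}" by (simp add: eventually_at_filter)
  have "((\<lambda>y. \<omega> \<bar>y - x\<bar>) \<longlongrightarrow> 0) (at x within {0..1})"
  proof (rule modulus_tendsto_0[OF assms(1)])
    show "((\<lambda>y. \<bar>y - x\<bar>) \<longlongrightarrow> 0) (at x within {0..1})" by (auto intro!: tendsto_eq_intros)
    show "\<forall>\<^sub>F y in at x within {0..1}. 0 \<le> \<bar>y - x\<bar> \<and> \<bar>y - x\<bar> \<le> 1"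
      using near by eventually_elim (use x in auto)
  qed
  then have "((\<lambda>y. K * \<omega> \<bar>y - x\<bar>) \<longlongrightarrow> 0) (at x within {0..1})" by (rule tendsto_mult_right_zero)
  then have "((\<lambda>y. g y - g x) \<longlongrightarrow> 0) (at x within {0..1})"
    by (rule Lim_null_comparison[rotated])
       (use near in eventually_elim, use assms(2) x in auto)
  then show "(g \<longlongrightarrow> g x) (at x within {0..1})" by (simp add: LIM_zero_iff)
qed

lemma oscillation01_le:
  assumes "modulus_of_continuity \<omega>" and "0 \<le> K" and "\<delta> \<in> {0..1}"
    and "\<And>x y. x \<in> {0..1} \<Longrightarrow> y \<in> {0..1} \<Longrightarrow> \<bar>g x - g y\<bar> \<le> K * \<omega> \<bar>x - y\<bar>"
  shows "oscillation01 g \<delta> \<le> K * \<omega> \<delta>"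
  unfolding oscillation01_def
proof (rule cSup_least)
  show "{\<bar>g x - g y\<bar> |x y. x \<in> {0..1} \<and> y \<in> {0..1} \<and> \<bar>x - y\<bar> \<le> \<delta>} \<noteq> {}"
    using assms(3) by (auto intro!: exI[of _ 0])
next
  fix u assume "u \<in> {\<bar>g x - g y\<bar> |x y. x \<in> {0..1} \<and> y \<in> {0..1} \<and> \<bar>x - y\<bar> \<le> \<delta>}"
  then obtain x y where xy: "u = \<bar>g x - g y\<bar>" "x \<in> {0..1}" "y \<in> {0..1}" "\<bar>x - y\<bar> \<le> \<delta>" by blast
  have "K * \<omega> \<bar>x - y\<bar> \<le> K * \<omega> \<delta>"
    using assms(2,3) xy by (intro mult_left_mono modulus_mono[OF assms(1)]) auto
  then show "u \<le> K * \<omega> \<delta>" using assms(4) xy by fastforce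
qed

section \<open>The primitive and its values at the nodes\<close>

context interpolation
begin

definition primitive :: "real \<Rightarrow> real" where
  "primitive x = integral {0..x} slope"

lemma primitive_0: "primitive 0 = 0"
  by (simp add: primitive_def)

lemma primitive_on_piece:
  assumes "continuous_on {0..1} slope" and "z (Suc k) \<le> x" and "x \<le> z k"
  defines "s \<equiv> (x - z (Suc k)) / len k"
  shows "primitive x = primitive (z (Suc k)) + len k * (d (Suc k) * (s - s\<^sup>2 / 2) + d k * (s\<^sup>2 / 2)
            + c k * (3 * s\<^sup>2 - 2 * s ^ 3))"
proof -
  have "x \<le> 1" using assms(3) z_le[of 0 k] z_0 by simp
  then have "slope integrable_on {0..x}"
    by (intro integrable_continuous_real continuous_on_subset[OF assms(1)]) auto
  then have "integral {0..x} slope = integral {0..z (Suc k)} slope + integral {z (Suc k)..x} slope"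
    using z_pos[of "Suc k"] assms(2) by (intro Henstock_Kurzweil_Integration.integral_combine[symmetric]) auto
  then show ?thesis
    using integral_unique[OF integral_piece[OF assms(2,3)]] by (simp add: primitive_def s_def)
qed

lemma primitive_has_derivative:
  assumes "continuous_on {0..1} slope" and "x \<in> {0..1}"
  shows "(primitive has_real_derivative slope x) (at x within {0..1})"
  using integral_has_real_derivative[OF assms] by (simp add: primitive_def[abs_def])

text \<open>
  The hypothesis \<open>step\<close> says that the increments of \<open>\<tau>\<close> are the integrals of \<open>slope\<close> over the
  intervals. So the values of the primitive at the nodes differ from \<open>\<tau>\<close> by a constant, and the
  constant is \<open>0\<close> because both sequences tend to \<open>0\<close>.
\<close>

lemma primitive_node:
  assumes cont: "continuous_on {0..1} slope" and lim: "\<tau> \<longlonglongrightarrow> 0"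
    and step: "\<And>k. \<tau> k - \<tau> (Suc k) = len k * ((d k + d (Suc k)) / 2 + c k)"
  shows "primitive (z k) = \<tau> k"
proof -
  have "primitive (z k) - \<tau> k = primitive (z (Suc k)) - \<tau> (Suc k)" for k
    using primitive_on_piece[OF cont, of k "z k"] z_Suc_less[of k] len_pos[of k] step[of k]
    by (simp add: algebra_simps flip: len_def)
  then have const: "primitive (z k) - \<tau> k = primitive (z 0) - \<tau> 0" for k
    by (induction k) auto
  have "continuous_on {0..1} primitive"
    unfolding continuous_on_eq_continuous_within
    using DERIV_continuous[OF primitive_has_derivative[OF cont]] by blast
  then have "(\<lambda>k. primitive (z k)) \<longlonglongrightarrow> primitive 0"
    by (rule continuous_on_tendsto_compose[OF _ z_lim])
       (use z_pos z_le[of 0] z_0 in \<open>auto intro!: always_eventually less_imp_le\<close>)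
  then have "(\<lambda>k. primitive (z k) - \<tau> k) \<longlonglongrightarrow> 0"
    using tendsto_diff[OF _ lim] by (fastforce simp: primitive_0)
  then have "(\<lambda>k::nat. primitive (z 0) - \<tau> 0) \<longlonglongrightarrow> 0"
    by (rule Lim_transform_eventually) (intro always_eventually allI const)
  then have "primitive (z 0) - \<tau> 0 = 0" using LIMSEQ_unique tendsto_const by blast
  then show ?thesis using const[of k] by simp
qed

end

section \<open>The diffeomorphism of a slowly accumulating node sequence\<close>

text \<open>
  The conditions on the nodes: the intervals shrink, and the ratio of the lengths of the intervals
  \<open>k + 2\<close> and \<open>k\<close> differs from \<open>1\<close> by \<open>O(\<omega>)\<close> of the length. The two bounds by \<open>1 / 8\<close> make the derivative
  positive.
\<close>

locale slow_nodes =
  fixes \<omega> :: "real \<Rightarrow> real" and z :: "nat \<Rightarrow> real" and C :: real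
  assumes modulus: "modulus_of_continuity \<omega>"
    and z_0: "z 0 = 1" and z_Suc_less: "z (Suc k) < z k" and z_lim: "z \<longlonglongrightarrow> 0"
    and gap_Suc: "z (Suc k) - z (Suc (Suc k)) \<le> z k - z (Suc k)"
    and small: "\<omega> (z (Suc k) - z (Suc (Suc k))) \<le> 1 / 8"
    and C_nonneg: "0 \<le> C" and \<omega>_pos: "0 < \<omega> (z 0 - z 1)"
    and ratio_small: "1 \<le> k \<Longrightarrow> \<bar>(z (k + 2) - z (k + 3)) / (z k - z (k + 1)) - 1\<bar> \<le> 1 / 8"
    and ratio: "1 \<le> k \<Longrightarrow>
      \<bar>(z (k + 2) - z (k + 3)) / (z k - z (k + 1)) - 1\<bar> \<le> C * \<omega> (z k - z (k + 1))"
begin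

text \<open>
  At the node \<open>z 0 = 1\<close>, which is the second fixed point, the derivative has to be \<open>1\<close>.
\<close>

definition node_slope :: "nat \<Rightarrow> real" where
  "node_slope k = (if k = 0 then 1 else 1 + (-1) ^ k * \<omega> (z k - z (Suc k)))"

definition node_image :: "nat \<Rightarrow> real" where
  "node_image k = (if k = 0 then 1 else z (k + 2))"

definition bump :: "nat \<Rightarrow> real" where
  "bump k = (node_image k - node_image (Suc k)) / (z k - z (Suc k)) - (node_slope k + node_slope (Suc k)) / 2"

text \<open>
  The bump is chosen so that the integral of the derivative over the \<open>k\<close>-th interval is
  \<open>node_image k - node_image (k + 1)\<close>.
\<close>

sublocale interpolation z node_slope bump
  by unfold_locales (rule z_0 z_Suc_less z_lim)+

lemma \<omega>_len_nonneg: "0 \<le> \<omega> (len k)"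
  by (rule modulus_nonneg[OF modulus]) (use len_pos len_le_1 in \<open>auto intro: less_imp_le\<close>)

lemma len_antimono: "i \<le> j \<Longrightarrow> len j \<le> len i"
  using lift_Suc_antimono_le[of len] gap_Suc by (simp add: len_def)

lemma \<omega>_len_antimono: "i \<le> j \<Longrightarrow> \<omega> (len j) \<le> \<omega> (len i)"
  by (rule modulus_mono[OF modulus]) (use len_antimono len_pos len_le_1 in \<open>auto intro: less_imp_le\<close>)

lemma \<omega>_len_small: "1 \<le> k \<Longrightarrow> \<omega> (len k) \<le> 1 / 8"
  using small[of "k - 1"] by (simp add: len_def)

lemma abs_node_slope_minus_1: "\<bar>node_slope k - 1\<bar> \<le> \<omega> (len k)"
  using \<omega>_len_nonneg[of k] by (cases "k = 0") (simp_all add: node_slope_def abs_mult flip: len_def)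

lemma abs_node_slope_Suc_minus_1: "\<bar>node_slope (Suc k) - 1\<bar> \<le> \<omega> (len k)"
  using abs_node_slope_minus_1[of "Suc k"] \<omega>_len_antimono[of k "Suc k"] by simp

lemma abs_bump_le:
  assumes "1 \<le> k"
  shows "\<bar>bump k\<bar> \<le> 1 / 4" and "\<bar>bump k\<bar> \<le> (C + 1) * \<omega> (len k)"
proof -
  define r where "r = (z (k + 2) - z (k + 3)) / (z k - z (k + 1))"
  have "bump k = (r - 1) - ((node_slope k - 1) + (node_slope (Suc k) - 1)) / 2"
    using assms by (simp add: bump_def node_image_def r_def eval_nat_numeral) (simp add: field_simps)
  moreover have "\<bar>(node_slope k - 1) + (node_slope (Suc k) - 1)\<bar> \<le> 2 * \<omega> (len k)"
    using abs_node_slope_minus_1[of k] abs_node_slope_Suc_minus_1[of k] by linarith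
  then have "\<bar>((node_slope k - 1) + (node_slope (Suc k) - 1)) / 2\<bar> \<le> \<omega> (len k)" by simp
  ultimately have *: "\<bar>bump k\<bar> \<le> \<bar>r - 1\<bar> + \<omega> (len k)" by linarith
  show "\<bar>bump k\<bar> \<le> 1 / 4"
    using * ratio_small[OF assms] \<omega>_len_small[OF assms] unfolding r_def by linarith
  have "\<bar>r - 1\<bar> \<le> C * \<omega> (len k)"
    using ratio[OF assms] by (simp add: r_def len_def)
  then show "\<bar>bump k\<bar> \<le> (C + 1) * \<omega> (len k)" using * by (simp add: distrib_right)
qed

text \<open>
  The interval next to \<open>1\<close> is not small, and its bump is only known to be some number. A single
  interval is harmless: the constant is enlarged by \<open>\<bar>bump 0\<bar> / \<omega> (len 0)\<close>.
\<close>

lemma slope_modulus_bound: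
  obtains K where "0 \<le> K"
    and "\<And>x y. x \<in> {0..1} \<Longrightarrow> y \<in> {0..1} \<Longrightarrow> \<bar>slope x - slope y\<bar> \<le> K * \<omega> \<bar>x - y\<bar>"
proof -
  define B where "B = C + 1 + \<bar>bump 0\<bar> / \<omega> (len 0)"
  have w0: "0 < \<omega> (len 0)" using \<omega>_pos by (simp add: len_def)
  have B: "C + 1 \<le> B" "1 \<le> B" using w0 C_nonneg by (auto simp: B_def)
  have "\<omega> (len k) \<le> B * \<omega> (len k)" for k
    using mult_right_mono[OF B(2) \<omega>_len_nonneg[of k]] by simp
  moreover have "\<bar>bump k\<bar> \<le> B * \<omega> (len k)" for k
  proof (cases k)
    case 0
    have "\<bar>bump 0\<bar> = (\<bar>bump 0\<bar> / \<omega> (len 0)) * \<omega> (len 0)" using w0 by simp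
    also have "\<dots> \<le> B * \<omega> (len 0)" using w0 C_nonneg by (intro mult_right_mono) (auto simp: B_def)
    finally show ?thesis by (simp add: 0)
  next
    case (Suc i)
    then show ?thesis
      using abs_bump_le(2)[of k] mult_right_mono[OF B(1) \<omega>_len_nonneg[of k]] by simp
  qed
  ultimately have "\<bar>slope x - slope y\<bar> \<le> 32 * B * \<omega> \<bar>x - y\<bar>" if "x \<in> {0..1}" "y \<in> {0..1}" for x y
    using B that len_antimono[of _ "Suc _"]
    by (intro slope_modulus[OF modulus]) (auto intro: order_trans[OF abs_node_slope_minus_1] order_trans[OF abs_node_slope_Suc_minus_1])
  then show thesis using that[of "32 * B"] B by simp
qed

lemma cont_slope: "continuous_on {0..1} slope"
  using slope_modulus_bound continuous_on_if_modulus[OF modulus] by metis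

text \<open>
  The first interval \<open>[z 1, 1]\<close> is mapped onto the longer interval \<open>[z 3, 1]\<close>, so the mean of the
  derivative exceeds \<open>1\<close> there, whereas the mean of its end values is \<open>1 - \<omega> (len 1) / 2\<close>.
\<close>

lemma bump_0_gt: "\<omega> (len 1) / 2 < bump 0"
proof -
  have "1 < (1 - z 3) / (1 - z 1)"
    using z_less[of 1 3] z_less[of 0 1] z_0 by simp
  moreover have "bump 0 = (1 - z 3) / (1 - z 1) - (1 + (1 - \<omega> (len 1))) / 2"
    by (simp add: bump_def node_image_def node_slope_def z_0 eval_nat_numeral flip: len_def)
  then have "bump 0 = (1 - z 3) / (1 - z 1) - 1 + \<omega> (len 1) / 2"
    by (simp add: add_divide_distrib diff_divide_distrib)
  ultimately show ?thesis by linarith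
qed

lemma slope_pos:
  assumes "x \<in> {0..1}"
  shows "0 < slope x"
proof (cases "x = 0")
  case True
  then show ?thesis by (simp add: slope_0)
next
  case False
  then obtain k where k: "z (Suc k) < x" "x \<le> z k"
    using interval_cases[of x] assms by auto
  show ?thesis
  proof (cases "k = 0")
    case True
    define s where "s = (x - z 1) / len 0"
    have s: "0 \<le> s" "s \<le> 1" using k True len_pos[of 0] by (auto simp: s_def len_def)
    have "slope x = 1 - \<omega> (len 1) * (1 - s) + 6 * (bump 0 * (s * (1 - s)))"
      unfolding slope_eq_piece[OF k] True piece_def Let_def One_nat_def[symmetric] s_def[symmetric]
      by (simp add: node_slope_def flip: len_def) (simp add: algebra_simps)
    moreover have "\<omega> (len 1) * (1 - s) \<le> 1 / 8 * 1"
      using s \<omega>_len_small[of 1] \<omega>_len_nonneg[of 1] by (intro mult_mono) auto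
    moreover have "0 \<le> bump 0 * (s * (1 - s))"
      using s bump_0_gt \<omega>_len_nonneg[of 1] by (intro mult_nonneg_nonneg) auto
    ultimately show ?thesis by linarith
  next
    case False
    then have "1 \<le> k" by simp
    have "\<bar>piece k x - 1\<bar> \<le> 1 / 8 + 3 / 2 * (1 / 4)"
      using k abs_bump_le(1)[OF \<open>1 \<le> k\<close>] abs_node_slope_minus_1[of k] abs_node_slope_Suc_minus_1[of k] \<omega>_len_small[OF \<open>1 \<le> k\<close>]
      by (intro piece_bounds) auto
    then show ?thesis unfolding slope_eq_piece[OF k] by linarith
  qed
qed

lemma node_image_lim: "node_image \<longlonglongrightarrow> 0"
proof -
  have "(\<lambda>k. node_image (Suc k)) \<longlonglongrightarrow> 0"
    using LIMSEQ_ignore_initial_segment[OF z_lim, of 3] by (simp add: node_image_def eval_nat_numeral)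
  then show ?thesis by (rule LIMSEQ_imp_Suc)
qed

lemma primitive_z: "primitive (z k) = node_image k"
  by (rule primitive_node[OF cont_slope node_image_lim])
     (use len_pos in \<open>simp add: bump_def less_imp_neq[symmetric] flip: len_def\<close>)

sublocale diffeo: interval_diffeo primitive slope
proof
  show "primitive 1 = 1" using primitive_z[of 0] by (simp add: z_0 node_image_def)
qed (use primitive_has_derivative[OF cont_slope] cont_slope slope_pos primitive_0 in auto)

text \<open>
  On the intervals with \<open>k \<ge> 1\<close> this is monotonicity: the interval is moved to the left of itself. On
  the first interval, in the coordinate \<open>s\<close> that runs from \<open>0\<close> to \<open>1\<close>, the difference \<open>x - primitive x\<close> is the
  polynomial \<open>len 0 (1 - s)\<^sup>2 (c (1 + 2 s) - A / 2)\<close> with \<open>c = bump 0\<close> and \<open>A = \<omega> (len 1)\<close>, which is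
  positive because \<open>c > A / 2\<close>.
\<close>

lemma primitive_less:
  assumes "0 < x" and "x < 1"
  shows "primitive x < x"
proof -
  obtain k where k: "z (Suc k) < x" "x \<le> z k"
    using interval_cases[of x] assms by auto
  show ?thesis
  proof (cases "k = 0")
    case True
    define s where "s = (x - z 1) / len 0"
    define A where "A = \<omega> (len 1)"
    have s: "0 \<le> s" "s < 1" using k True len_pos[of 0] assms z_0 by (auto simp: s_def len_def)
    have x: "x = z 1 + len 0 * s" using len_pos[of 0] by (simp add: s_def)
    have d01: "node_slope 0 = 1" "node_slope 1 = 1 - A" by (auto simp: node_slope_def A_def len_def)
    have "primitive x = primitive (z 1) + len 0 * (node_slope 1 * (s - s\<^sup>2 / 2) + node_slope 0 * (s\<^sup>2 / 2) + bump 0 * (3 * s\<^sup>2 - 2 * s ^ 3))"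
      using primitive_on_piece[OF cont_slope, of 0 x] k True
      unfolding One_nat_def[symmetric] s_def[symmetric] by simp
    then have px: "primitive x = z 3 + len 0 * ((1 - A) * (s - s\<^sup>2 / 2) + s\<^sup>2 / 2 + bump 0 * (3 * s\<^sup>2 - 2 * s ^ 3))"
      unfolding primitive_z d01 by (simp add: node_image_def eval_nat_numeral)
    moreover have "1 = z 3 + len 0 * ((1 - A) / 2 + 1 / 2 + bump 0)"
      using primitive_on_piece[OF cont_slope, of 0 1] primitive_z[of 1] primitive_z[of 0] d01 len_pos[of 0] z_0
        z_Suc_less[of 0]
      by (simp add: node_image_def eval_nat_numeral len_def)
    moreover have "z 1 = 1 - len 0" by (simp add: len_def z_0)
    ultimately
    have z3: "z 3 = 1 - len 0 * ((1 - A) / 2 + 1 / 2 + bump 0)" and z1: "z 1 = 1 - len 0"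
      by simp_all
    have "x - primitive x = len 0 * ((1 - s)\<^sup>2 * (bump 0 * (1 + 2 * s) - A / 2))"
      unfolding px z3 unfolding x z1 by (simp add: field_simps power2_eq_square power3_eq_cube)
    moreover have "bump 0 * 1 \<le> bump 0 * (1 + 2 * s)"
      using bump_0_gt \<omega>_len_nonneg[of 1] s by (intro mult_left_mono) auto
    then have "0 < bump 0 * (1 + 2 * s) - A / 2" using bump_0_gt by (simp add: A_def)
    then have "0 < len 0 * ((1 - s)\<^sup>2 * (bump 0 * (1 + 2 * s) - A / 2))"
      using s len_pos[of 0] by (intro mult_pos_pos) auto
    ultimately show ?thesis by simp
  next
    case False
    have "primitive x \<le> primitive (z k)"
      using diffeo.mono[of x "z k"] k assms z_le[of 0 k] z_0 by simp
    also have "\<dots> = z (k + 2)" using False by (simp add: primitive_z node_image_def)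
    also have "\<dots> < z (Suc k)" by (rule z_less) simp
    finally show ?thesis using k by simp
  qed
qed

lemma growth_rate_primitive: "growth_rate primitive = 1"
  using diffeo.growth_rate_eq_1 primitive_less slope_0 slope_node[of 0] z_0 by (simp add: node_slope_def)

lemma primitive_in_Diff0_mod: "primitive \<in> Diff0_mod \<omega>"
proof -
  obtain K where K: "0 \<le> K" "\<And>x y. x \<in> {0..1} \<Longrightarrow> y \<in> {0..1} \<Longrightarrow> \<bar>slope x - slope y\<bar> \<le> K * \<omega> \<bar>x - y\<bar>"
    using slope_modulus_bound by blast
  have "oscillation01 (deriv01 primitive) \<delta> \<le> K * \<omega> \<delta>" if "\<delta> \<in> {0..1}" for \<delta>
    by (rule oscillation01_le[OF modulus K(1) that]) (simp add: diffeo.deriv01_eq K(2))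
  then show ?thesis using diffeo.in_Diff0 unfolding Diff0_mod_def by blast
qed

text \<open>
  The orbit of \<open>z 2\<close> consists of even nodes, where the derivative is \<open>1 + \<omega> (len k)\<close>. Each factor
  contributes at least \<open>\<omega> (len (2 n)) / 2\<close> to the logarithm.
\<close>

lemma ln_growth_seq_ge: "real n / 2 * \<omega> (len (2 * n)) \<le> ln (growth_seq primitive n)"
proof -
  have orbit: "(primitive ^^ j) (z 2) = z (2 + 2 * j)" for j
    by (induction j) (simp_all add: primitive_z node_image_def eval_nat_numeral)
  \<comment> \<open>For \<open>0 \<le> w \<le> 1 / 2\<close> one has \<open>ln (1 + w) \<ge> w - w\<^sup>2 \<ge> w / 2\<close>.\<close>
  have w: "0 \<le> \<omega> (len (2 + 2 * j))" "\<omega> (len (2 + 2 * j)) \<le> 1 / 2" for j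
    using \<omega>_len_nonneg[of "2 + 2 * j"] \<omega>_len_small[of "2 + 2 * j"] by auto
  have "real n / 2 * \<omega> (len (2 * n)) = (\<Sum>j<n. \<omega> (len (2 * n)) / 2)" by simp
  also have "\<dots> \<le> (\<Sum>j<n. ln (1 + \<omega> (len (2 + 2 * j))))"
  proof (rule sum_mono)
    fix j assume "j \<in> {..<n}"
    then have "\<omega> (len (2 * n)) \<le> \<omega> (len (2 + 2 * j))" by (intro \<omega>_len_antimono) auto
    also have "\<dots> / 2 \<le> ln (1 + \<omega> (len (2 + 2 * j)))"
      using w[of j] ln_one_plus_pos_lower_bound[of "\<omega> (len (2 + 2 * j))"]
        mult_left_mono[OF w(2)[of j] w(1)[of j]] by (simp add: power2_eq_square)
    finally show "\<omega> (len (2 * n)) / 2 \<le> ln (1 + \<omega> (len (2 + 2 * j)))" by simp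
  qed
  also have "\<dots> = ln (\<Prod>j<n. 1 + \<omega> (len (2 + 2 * j)))"
  proof (rule ln_prod[symmetric])
    show "1 + \<omega> (len (2 + 2 * j)) \<noteq> 0" for j using w(1)[of j] by linarith
  qed simp
  also have "(\<Prod>j<n. 1 + \<omega> (len (2 + 2 * j))) = (\<Prod>j<n. slope ((primitive ^^ j) (z 2)))"
    unfolding orbit slope_node by (simp add: node_slope_def len_def)
  also have "ln \<dots> \<le> ln (growth_seq primitive n)"
  proof -
    have z2: "z 2 \<in> {0..1}" using z_pos[of 2] z_le[of 0 2] z_0 by auto
    have "0 < (\<Prod>j<n. slope ((primitive ^^ j) (z 2)))"
      by (intro prod_pos slope_pos funpow_mem[of primitive "{0..1}"] ballI) (use z2 diffeo.image in auto)
    then show ?thesis using diffeo.prod_deriv_le_growth_seq[OF z2, of n] by simp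
  qed
  finally show ?thesis .
qed

end

section \<open>Logarithmic nodes\<close>

definition log_gap :: "real \<Rightarrow> real" where
  "log_gap x = 1 / ln x - 1 / ln (x + 1)"

text \<open>
  The nodes are \<open>1 / ln (k + M)\<close> for \<open>k \<ge> 1\<close>, so the lengths are values of \<open>log_gap\<close>. Every condition holds
  for large arguments of \<open>log_gap\<close>, and a large shift \<open>M\<close> makes them hold from the start. The
  bound \<open>3 / x\<close> for the relative change of \<open>log_gap\<close> over two steps is compared with \<open>\<omega>\<close> by
  \<open>\<omega> (log_gap x) \<ge> b (log_gap x)\<^sup>\<alpha> \<ge> b / x\<close>, where the last step uses \<open>log_gap x \<ge> x\<^sup>p\<close> with \<open>p = - 1 / \<alpha> < - 1\<close>.
\<close>

lemma slow_nodes_exist: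
  assumes mod: "modulus_of_continuity \<omega>" and w1: "\<omega> 1 \<noteq> 0" and \<alpha>: "0 < \<alpha>" "\<alpha> < 1"
    and a: "0 < a" "a < 1" and anti: "antimono_on {0<..<a} (\<lambda>x. \<omega> x / x powr \<alpha>)"
  obtains z C where "slow_nodes \<omega> z C"
    and "\<And>\<epsilon>. 0 < \<epsilon> \<Longrightarrow>
      \<forall>\<^sub>F n in sequentially. real n powr (- 1 - \<epsilon>) \<le> z (2 * n) - z (Suc (2 * n))"
proof -
  obtain b where b: "0 < b" "\<And>t. 0 < t \<Longrightarrow> t \<le> a / 2 \<Longrightarrow> b * t powr \<alpha> \<le> \<omega> t"
    using modulus_ge_powr[OF mod w1 a anti] by blast
  have lim: "(log_gap \<longlongrightarrow> 0) at_top" unfolding log_gap_def by real_asymp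
  have pos: "\<forall>\<^sub>F x in at_top. 0 < log_gap x" unfolding log_gap_def by real_asymp
  have le_a: "\<forall>\<^sub>F x in at_top. log_gap x < a / 2" by (rule order_tendstoD(2)[OF lim]) (use a in simp)
  have "\<forall>\<^sub>F x in at_top. 0 \<le> log_gap x \<and> log_gap x \<le> 1"
    using pos le_a by eventually_elim (use a in auto)
  then have "\<forall>\<^sub>F x in at_top. \<omega> (log_gap x) < 1 / 8"
    using order_tendstoD(2)[OF modulus_tendsto_0[OF mod lim], of "1 / 8"] by simp
  moreover have "\<forall>\<^sub>F x in at_top. log_gap (x + 1) \<le> log_gap x"
    unfolding log_gap_def by real_asymp
  moreover have "\<forall>\<^sub>F x in at_top. log_gap (x + 2) \<le> log_gap x"
    unfolding log_gap_def by real_asymp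
  moreover have "\<forall>\<^sub>F x in at_top. log_gap x - log_gap (x + 2) \<le> 3 / x * log_gap x"
    unfolding log_gap_def by real_asymp
  moreover have "\<forall>\<^sub>F x in at_top. x powr - p \<le> log_gap x" if "1 < p" for p
    using that unfolding log_gap_def by real_asymp
  then have "\<forall>\<^sub>F x in at_top. x powr - (1 / \<alpha>) \<le> log_gap x"
    using \<alpha> by simp
  moreover have "\<forall>\<^sub>F x :: real in at_top. 1 / ln x \<le> 1 / 2" by real_asymp
  moreover have "\<forall>\<^sub>F x :: real in at_top. 24 \<le> x" by (rule eventually_ge_at_top)
  ultimately have "\<forall>\<^sub>F x in at_top. 0 < log_gap x \<and> log_gap x < a / 2 \<and> \<omega> (log_gap x) < 1 / 8
      \<and> log_gap (x + 1) \<le> log_gap x \<and> log_gap (x + 2) \<le> log_gap x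
      \<and> log_gap x - log_gap (x + 2) \<le> 3 / x * log_gap x \<and> x powr - (1 / \<alpha>) \<le> log_gap x
      \<and> 1 / ln x \<le> 1 / 2 \<and> 24 \<le> x"
    using pos le_a by eventually_elim blast
  then obtain X where X: "\<And>x. X \<le> x \<Longrightarrow> 0 < log_gap x \<and> log_gap x < a / 2 \<and> \<omega> (log_gap x) < 1 / 8
      \<and> log_gap (x + 1) \<le> log_gap x \<and> log_gap (x + 2) \<le> log_gap x
      \<and> log_gap x - log_gap (x + 2) \<le> 3 / x * log_gap x \<and> x powr - (1 / \<alpha>) \<le> log_gap x
      \<and> 1 / ln x \<le> 1 / 2 \<and> 24 \<le> x"
    unfolding eventually_at_top_linorder by blast
  obtain M :: nat where M: "X \<le> real M" using real_arch_simple by blast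
  define z :: "nat \<Rightarrow> real" where "z k = (if k = 0 then 1 else 1 / ln (real k + real M))" for k
  note P = X[OF order_trans[OF M]]
  have gap: "z k - z (Suc k) = log_gap (real k + real M)" if "1 \<le> k" for k
    using that by (simp add: z_def log_gap_def add_ac)
  \<comment> \<open>The first interval joins the sequence to the end point \<open>1\<close>. It is at least \<open>1 / 2\<close> long, and
    the second one at most \<open>1 / 2\<close>, so the lengths decrease there, too.\<close>
  have gap0: "1 / 2 \<le> z 0 - z 1"
    using P[of "1 + real M"] by (simp add: z_def)
  have half: "z 1 \<le> 1 / 2" "log_gap (1 + real M) \<le> 1 / 2"
    using P[of "1 + real M"] a by (auto simp: z_def)
  have ratio: "\<bar>(z (k + 2) - z (k + 3)) / (z k - z (k + 1)) - 1\<bar> \<le> 3 / (real k + real M)" if "1 \<le> k" for k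
  proof -
    define x where "x = real k + real M"
    have x: "real M \<le> x" by (simp add: x_def)
    have "z (k + 2) - z (k + 3) = log_gap (x + 2)"
      using gap[of "k + 2"] by (simp add: x_def add_ac eval_nat_numeral)
    moreover have "z k - z (k + 1) = log_gap x" using gap[OF that] by (simp add: x_def)
    moreover have "\<bar>log_gap (x + 2) / log_gap x - 1\<bar> = (log_gap x - log_gap (x + 2)) / log_gap x"
      using P[OF x] by (simp add: field_simps abs_if)
    moreover have "(log_gap x - log_gap (x + 2)) / log_gap x \<le> 3 / x"
      using P[OF x] by (simp add: pos_divide_le_eq)
    ultimately show ?thesis by (simp add: x_def)
  qed
  have le_ratio: "3 / (real k + real M) \<le> 3 / b * \<omega> (z k - z (k + 1))" if "1 \<le> k" for k
  proof -
    define x where "x = real k + real M"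
    have x: "real M \<le> x" "0 < x" using P[of x] by (auto simp: x_def)
    have "b * (1 / x) = b * (x powr - (1 / \<alpha>)) powr \<alpha>"
      unfolding powr_powr using \<alpha> x by (simp add: powr_minus_divide)
    also have "\<dots> \<le> b * log_gap x powr \<alpha>"
      using P[OF x(1)] b \<alpha> by (intro mult_left_mono powr_mono2) auto
    also have "\<dots> \<le> \<omega> (log_gap x)" using P[OF x(1)] by (intro b) auto
    finally have "1 / x \<le> \<omega> (log_gap x) / b" using b(1) by (simp add: field_simps)
    then show ?thesis using gap[OF that] by (simp add: x_def)
  qed
  have "slow_nodes \<omega> z (3 / b)"
  proof
    show "modulus_of_continuity \<omega>" by fact
    show "z 0 = 1" by (simp add: z_def)
    show "z (Suc k) < z k" for k
      using gap[of k] P[of "real k + real M"] gap0 by (cases "k = 0") auto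
    have "(\<lambda>k. 1 / ln (real k + real M)) \<longlonglongrightarrow> 0" by real_asymp
    then show "z \<longlonglongrightarrow> 0"
      by (rule Lim_transform_eventually) (auto simp: z_def eventually_sequentially intro!: exI[of _ 1])
    show "z (Suc k) - z (Suc (Suc k)) \<le> z k - z (Suc k)" for k
    proof (cases "k = 0")
      case True
      then show ?thesis using gap[of 1] gap0 half by simp
    next
      case False
      then show ?thesis using gap[of k] gap[of "Suc k"] P[of "real k + real M"] by (simp add: add_ac)
    qed
    show "\<omega> (z (Suc k) - z (Suc (Suc k))) \<le> 1 / 8" for k
      using gap[of "Suc k"] P[of "real (Suc k) + real M"] by simp
    show "0 \<le> 3 / b" using b by simp
    show "0 < \<omega> (z 0 - z 1)"
      using gap0 P[of "1 + real M"] by (intro modulus_pos[OF mod w1]) (auto simp: z_def)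
    fix k :: nat assume k: "1 \<le> k"
    show "\<bar>(z (k + 2) - z (k + 3)) / (z k - z (k + 1)) - 1\<bar> \<le> 3 / b * \<omega> (z k - z (k + 1))"
      using ratio[OF k] le_ratio[OF k] by linarith
    have "3 / (real k + real M) \<le> 3 / 24"
      using P[of "real k + real M"] by (intro divide_left_mono) auto
    then show "\<bar>(z (k + 2) - z (k + 3)) / (z k - z (k + 1)) - 1\<bar> \<le> 1 / 8"
      using ratio[OF k] by linarith
  qed
  moreover have "\<forall>\<^sub>F n in sequentially. real n powr (- 1 - \<epsilon>) \<le> z (2 * n) - z (Suc (2 * n))"
    if "0 < \<epsilon>" for \<epsilon>
  proof -
    have "\<forall>\<^sub>F n in sequentially. real n powr (- 1 - \<epsilon>) \<le> log_gap (real (2 * n) + real M)"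
      using that unfolding log_gap_def by real_asymp
    then show ?thesis using eventually_ge_at_top[of 1]
      by eventually_elim (use gap in simp)
  qed
  ultimately show thesis using that by blast
qed

section \<open>The growth of the derivatives\<close>

theorem theorem7:
  fixes \<omega> :: "real \<Rightarrow> real" and \<alpha> a :: real
  assumes "modulus_of_continuity \<omega>"
    and "0 < \<alpha>" and "\<alpha> < 1"
    and "0 < a" and "a < 1"
    and "antimono_on {0<..<a} (\<lambda>x. \<omega> x / x powr \<alpha>)"
  shows "\<exists>f \<in> Diff0_mod \<omega>. growth_rate f = 1 \<and>
           (\<forall>\<epsilon>>0. \<exists>c>0. \<forall>\<^sub>F n in sequentially.
              ln (growth_seq f n) \<ge> c * real n powr (1 - \<epsilon>) * \<omega> (1 / real n))"
proof (cases "\<omega> 1 = 0")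
  case True
  \<comment> \<open>Monotonicity makes \<open>\<omega>\<close> vanish, the right-hand side is \<open>0\<close>, and the identity suffices.\<close>
  have \<omega>: "\<omega> t = 0" if "t \<in> {0..1}" for t
    using modulus_nonneg[OF assms(1), of t] modulus_mono[OF assms(1), of t 1] that True by auto
  interpret interval_diffeo id "\<lambda>_. 1"
    by unfold_locales (auto simp: id_def)
  have inv: "deriv01 (inv01 id ^^ n) x = 1" if "x \<in> {0..1}" for n x
    using deriv01_funpow_eq_prod[OF deriv_inv _ that, of n] inv_mem by (simp add: image_subset_iff)
  have growth: "growth_seq id n = 1" for n
  proof -
    have "(\<lambda>x. \<bar>deriv01 (id ^^ n) x\<bar>) ` {0..1} = {1}"
      using deriv01_eq by force
    moreover have "(\<lambda>x. \<bar>deriv01 (inv01 id ^^ n) x\<bar>) ` {0..1} = {1}"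
      using inv by force
    ultimately show ?thesis by (simp add: growth_seq_def supnorm01_def)
  qed
  show ?thesis
  proof (intro bexI[of _ id] conjI allI impI)
    have "root n 1 = 1" if "n \<ge> 1" for n using that by simp
    then have "(\<lambda>n. root n (growth_seq id n)) \<longlonglongrightarrow> 1"
      unfolding growth by (intro tendsto_eventually) (auto simp: eventually_sequentially intro!: exI[of _ 1])
    then show "growth_rate id = 1" unfolding growth_rate_def by (rule limI)
    have "oscillation01 (deriv01 id) \<delta> \<le> 0 * \<omega> \<delta>" if "\<delta> \<in> {0..1}" for \<delta>
      by (rule oscillation01_le[OF assms(1) _ that]) (auto simp: deriv01_eq)
    then show "id \<in> Diff0_mod \<omega>" using in_Diff0 unfolding Diff0_mod_def by blast
    show "\<exists>c>0. \<forall>\<^sub>F n in sequentially.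
        ln (growth_seq id n) \<ge> c * real n powr (1 - \<epsilon>) * \<omega> (1 / real n)" for \<epsilon>
    proof -
      have "\<omega> (1 / real n) = 0" for n by (rule \<omega>) (cases n, auto)
      then show ?thesis unfolding growth by (intro exI[of _ 1]) simp
    qed
  qed
next
  case False
  then obtain z C where "slow_nodes \<omega> z C"
    and len_ge: "\<And>\<epsilon>. 0 < \<epsilon> \<Longrightarrow>
      \<forall>\<^sub>F n in sequentially. real n powr (- 1 - \<epsilon>) \<le> z (2 * n) - z (Suc (2 * n))"
    using slow_nodes_exist[OF assms(1) _ assms(2-6)] by blast
  then interpret slow_nodes \<omega> z C by simp
  show ?thesis
  proof (intro bexI[of _ primitive] conjI allI impI growth_rate_primitive primitive_in_Diff0_mod)
    fix \<epsilon> :: real assume \<epsilon>: "0 < \<epsilon>"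
    have "\<forall>\<^sub>F n in sequentially. ln (growth_seq primitive n) \<ge> 1 / 4 * real n powr (1 - \<epsilon>) * \<omega> (1 / real n)"
      using len_ge[OF \<epsilon>] eventually_ge_at_top[of 1]
    proof eventually_elim
      case (elim n)
      \<comment> \<open>The length \<open>t\<close> lies below both \<open>len (2 n)\<close> and \<open>1 / n\<close>. Passing from \<open>1 / n\<close> to \<open>t\<close> costs a
        factor \<open>2 n\<^sup>\<epsilon>\<close>, which together with the factor \<open>1 / 2\<close> of the growth bound leaves \<open>1 / 4\<close>.\<close>
      define t where "t = real n powr (- 1 - \<epsilon>)"
      have n: "0 < real n" using elim by simp
      have t: "0 < t" "t \<le> len (2 * n)" using elim by (auto simp: t_def len_def)
      have "t \<le> real n powr - 1" using elim \<epsilon> unfolding t_def by (intro powr_mono) auto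
      then have t_le: "t \<le> 1 / real n" using n by (simp add: powr_minus_divide)
      have "\<omega> (1 / real n) \<le> 2 * ((1 / real n) / t) * \<omega> t"
        by (rule modulus_ratio_le[OF assms(1) t(1) t_le]) (use elim in simp)
      also have "(1 / real n) / t = real n powr \<epsilon>"
        using n by (simp add: t_def powr_minus_divide powr_diff powr_minus)
      finally have "1 / 4 * real n powr (1 - \<epsilon>) * \<omega> (1 / real n)
          \<le> 1 / 4 * real n powr (1 - \<epsilon>) * (2 * real n powr \<epsilon> * \<omega> t)"
        by (intro mult_left_mono) auto
      also have "\<dots> = real n / 2 * \<omega> t"
        using n by (simp add: powr_diff)
      also have "\<dots> \<le> real n / 2 * \<omega> (len (2 * n))"
        using t len_le_1 n by (intro mult_left_mono modulus_mono[OF assms(1)]) auto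
      also have "\<dots> \<le> ln (growth_seq primitive n)" by (rule ln_growth_seq_ge)
      finally show ?case .
    qed
    then show "\<exists>c>0. \<forall>\<^sub>F n in sequentially.
        ln (growth_seq primitive n) \<ge> c * real n powr (1 - \<epsilon>) * \<omega> (1 / real n)"
      by (intro exI[of _ "1 / 4"]) auto
  qed
qed

end
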